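(* For $k\ge 0$ define strings over $\{a,b\}$ by $B_0=b$ and, for $i\ge 1$, $B_i=(a^iba^1b)(a^iba^2b)\cdots(a^iba^{i-1}b)\,a^ib$ (so $B_1=ab$, $B_2=a^2baba^2b$), and let $s_k=B_0B_1\cdots B_k\,a$. For $k\ge 2$, let $m_k$ be the size of the Lyndon factorization of $s_k$ and $z_k$ the size of the non-overlapping LZ factorization of $s_k$. Then $m_k=k^2/2+k/2+2$, $z_k=k^2/2-k/2+4$, and thus $m_k=z_k+\Theta(\sqrt{z_k})$.
   Context: The alphabet is $\{a,b\}$ ordered by $a\prec b$; $u^j$ denotes $j$ concatenated copies of $u$. Lexicographic order: $u\preceq v$ if either $u$ is a prefix of $v$, or $u=xcw_1$, $v=xdw_2$ with letters $c\prec d$. A Lyndon word is a nonempty string strictly lexicographically smaller than each of its nonempty proper suffixes. The Lyndon factorization of $s$ is the unique factorization $s=f_1^{e_1}\cdots f_m^{e_m}$ with each $f_i$ a Lyndon word, $e_i\ge1$, and $f_i\succ f_{i+1}$; its size is $m$. The non-overlapping LZ factorization $s=p_1\cdots p_z$ is built greedily left to right: each phrase $p_i$ is either the leftmost occurrence in $s$ of a letter, or the longest prefix of $p_i\cdots p_z$ occurring as a substring of $p_1\cdots p_{i-1}$; its size is $z$. *)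

theory Defs
  imports Complex_Main "HOL-Library.Sublist" "HOL-Library.List_Lexorder"
    "HOL-Library.Landau_Symbols"
begin

datatype letter = LA | LB

instantiation letter :: linorder
begin

definition less_letter :: "letter \<Rightarrow> letter \<Rightarrow> bool" where
  "less_letter x y \<longleftrightarrow> x = LA \<and> y = LB"

definition less_eq_letter :: "letter \<Rightarrow> letter \<Rightarrow> bool" where
  "less_eq_letter x y \<longleftrightarrow> x = y \<or> x < (y :: letter)"

instance
proof
  fix x y :: letter
  show "x \<le> y \<or> y \<le> x"
    by (cases x; cases y) (simp_all add: less_letter_def less_eq_letter_def)
qed (auto simp: less_letter_def less_eq_letter_def)

end

text \<open>
  On lists, \<open>\<le>\<close> and \<open><\<close> are the lexicographic order of
  \<^theory>\<open>HOL-Library.List_Lexorder\<close>, in which a proper prefix of a word precedes it.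
\<close>

definition word_pow :: "'a list \<Rightarrow> nat \<Rightarrow> 'a list" where
  "word_pow u n = concat (replicate n u)"

definition lyndon :: "'a :: linorder list \<Rightarrow> bool" where
  "lyndon w \<longleftrightarrow> w \<noteq> [] \<and> (\<forall>v. strict_suffix v w \<and> v \<noteq> [] \<longrightarrow> w < v)"

text \<open>
  The factorization \<open>f\<^sub>1\<^bsup>e\<^sub>1\<^esup> \<dots> f\<^sub>m\<^bsup>e\<^sub>m\<^esup>\<close> is the list of
  the pairs \<open>(f\<^sub>i, e\<^sub>i)\<close>, so repetitions of a factor count once towards the size.
\<close>

definition is_lyndon_factorization ::
    "'a :: linorder list \<Rightarrow> ('a list \<times> nat) list \<Rightarrow> bool" where
  "is_lyndon_factorization s fs \<longleftrightarrow>
     s = concat (map (\<lambda>(f, e). word_pow f e) fs) \<and>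
     (\<forall>(f, e) \<in> set fs. lyndon f \<and> e \<ge> 1) \<and>
     successively (\<lambda>f g. f > g) (map fst fs)"

definition lyndon_factorization :: "'a :: linorder list \<Rightarrow> ('a list \<times> nat) list" where
  "lyndon_factorization s = (THE fs. is_lyndon_factorization s fs)"

definition lyndon_size :: "'a :: linorder list \<Rightarrow> nat" where
  "lyndon_size s = length (lyndon_factorization s)"

text \<open>
  \<open>is_lz_phrase u v p\<close>: \<open>p\<close> is the phrase that starts the unprocessed part \<open>v\<close> when \<open>u\<close>
  is the part already factorized. The two cases exclude each other, since a nonempty
  prefix of \<open>v\<close> occurring in \<open>u\<close> forces the first letter of \<open>v\<close> to occur in \<open>u\<close>.
\<close>

definition is_lz_phrase :: "'a list \<Rightarrow> 'a list \<Rightarrow> 'a list \<Rightarrow> bool" where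
  "is_lz_phrase u v p \<longleftrightarrow>
     (\<exists>c w. v = c # w \<and> c \<notin> set u \<and> p = [c]) \<or>
     (p \<noteq> [] \<and> prefix p v \<and> sublist p u \<and>
      (\<forall>q. prefix q v \<and> sublist q u \<longrightarrow> length q \<le> length p))"

definition is_lz_factorization :: "'a list \<Rightarrow> 'a list list \<Rightarrow> bool" where
  "is_lz_factorization s ps \<longleftrightarrow>
     s = concat ps \<and>
     (\<forall>i < length ps. is_lz_phrase (concat (take i ps)) (concat (drop i ps)) (ps ! i))"

definition lz_factorization :: "'a list \<Rightarrow> 'a list list" where
  "lz_factorization s = (THE ps. is_lz_factorization s ps)"

definition lz_size :: "'a list \<Rightarrow> nat" where
  "lz_size s = length (lz_factorization s)"

definition block :: "nat \<Rightarrow> letter list" where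
  "block i =
     (if i = 0 then [LB]
      else concat (map (\<lambda>j. word_pow [LA] i @ [LB] @ word_pow [LA] j @ [LB]) [1..<i])
           @ word_pow [LA] i @ [LB])"

definition s_word :: "nat \<Rightarrow> letter list" where
  "s_word k = concat (map block [0..<Suc k]) @ [LA]"

end

theory Submission
  imports Defs "HOL-Real_Asymp.Real_Asymp"
begin

text \<open>
  The Lyndon factors of \<open>s\<^sub>k\<close> can be read off its definition: they are the words
  \<open>a\<^sup>i b a\<^sup>j b\<close> (\<open>j < i\<close>) and \<open>a\<^sup>i b\<close> making up the blocks, and a final \<open>a\<close>.

  For \<open>n \<ge> 3\<close> the LZ phrases of \<open>s\<^sub>n\<close> extend those of \<open>s\<^sub>n\<^sub>-\<^sub>1\<close> by \<open>n - 1\<close> new ones: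
  \<open>a\<^sup>n\<^sup>-\<^sup>1 b a b a\<^sup>n\<^sup>-\<^sup>1\<close>, then \<open>a b a\<^sup>j b a\<^sup>n\<^sup>-\<^sup>1\<close> for \<open>j = 2, \<dots>, n - 2\<close>, and finally
  \<open>a b a\<^sup>n\<^sup>-\<^sup>1 b a\<^sup>n b a\<close>. What follows a new phrase, or the last phrase of \<open>s\<^sub>n\<^sub>-\<^sub>1\<close>, is empty or
  starts with \<open>a\<close>. Each new phrase occurs earlier, while its extension by \<open>a\<close> does not:
  the first extension would need a run \<open>a\<^sup>n\<close> and the middle ones adjacent runs \<open>a\<^sup>j b a\<^sup>n\<close>, none of
  which has occurred so far; the last one contains \<open>a\<^sup>n\<^sup>-\<^sup>1 b a\<^sup>n\<close>, whose sole earlier occurrence is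
  followed by \<open>b a b\<close>.
\<close>

section \<open>Uniqueness of Lyndon factorizations\<close>

lemma prefix_imp_le_list: "prefix u v \<Longrightarrow> u \<le> (v :: 'a :: linorder list)"
proof (induction u arbitrary: v)
  case (Cons x u)
  then show ?case by (cases v) auto
qed simp

text \<open>If \<open>w\<close> were longer, it would end inside a later factor \<open>l'\<close>,
  and its part \<open>v\<close> there would be both a proper suffix of \<open>w\<close> and a prefix
  of \<open>l'\<close>. The chain \<open>w < v \<le> l' \<le> l \<le> w\<close> is absurd.\<close>

lemma lyndon_prefix_bound:
  fixes ls :: "'a :: linorder list list"
  assumes "sorted_wrt (\<ge>) (l # ls)" and "lyndon w"
    and "prefix w (concat (l # ls))"
  shows "length w \<le> length l"
proof (rule ccontr)
  assume "\<not> length w \<le> length l"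
  have *: "\<exists>v l'. v \<noteq> [] \<and> suffix v y \<and> l' \<in> set ls \<and> prefix v l'"
    if "prefix y (concat ls)" "y \<noteq> []" for y and ls :: "'a list list"
    using that
  proof (induction ls arbitrary: y)
    case (Cons a ls)
    then have "prefix y a \<or> (\<exists>y'. y = a @ y' \<and> prefix y' (concat ls))"
      by (auto simp: prefix_append)
    then consider "prefix y a" | y' where "y = a @ y'" "prefix y' (concat ls)" "y' \<noteq> []"
      by fastforce
    then show ?case
    proof cases
      case 1
      then show ?thesis using Cons.prems by auto
    next
      case 2
      from Cons.IH[OF 2(2,3)] show ?thesis
        using 2(1) by (auto simp: suffix_def)
    qed
  qed simp
  have "\<not> prefix w l" using \<open>\<not> length w \<le> length l\<close> prefix_length_le by blast
  then obtain y where y: "w = l @ y" "prefix y (concat ls)" "y \<noteq> []"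
    using assms(3) by (auto simp: prefix_append)
  obtain v l' where v: "v \<noteq> []" "suffix v y" "l' \<in> set ls" "prefix v l'"
    using *[OF y(2,3)] by blast
  show False
  proof (cases "l = []")
    \<comment> \<open>With \<open>l\<close> empty, \<open>v\<close> could be all of
      \<open>w\<close>; but then sortedness makes \<open>l'\<close> empty as well, which its
      nonempty prefix \<open>v\<close> forbids.\<close>
    case True
    then have "l' \<le> []" using assms(1) v(3) by auto
    then show False using v by (cases l') auto
  next
    case False
    then have "strict_suffix v w"
      using v(2) y(1) by (auto simp: strict_suffix_def suffix_def)
    then have "w < v" using assms(2) v(1) by (auto simp: lyndon_def)
    also have "v \<le> l'" using v(4) by (rule prefix_imp_le_list)
    also have "l' \<le> l" using assms(1) v(3) by auto
    also have "l \<le> w" using y(1) by (auto intro: prefix_imp_le_list)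
    finally show False by simp
  qed
qed

lemma concat_word_pow:
  "concat (map (\<lambda>(f, e). word_pow f e) fs) = concat (concat (map (\<lambda>(f, e). replicate e f) fs))"
  by (induction fs) (auto simp: word_pow_def)

lemma is_lyndon_factorization_Cons:
  "is_lyndon_factorization s ((f, e) # fs) \<longleftrightarrow>
     (\<exists>s'. s = word_pow f e @ s' \<and> is_lyndon_factorization s' fs) \<and> lyndon f \<and> e \<ge> 1 \<and>
     (fs \<noteq> [] \<longrightarrow> f > fst (hd fs))"
  by (cases fs) (auto simp: is_lyndon_factorization_def)

text \<open>Together with \<open>f\<close> being a Lyndon prefix itself, this characterizes the
  first factor as the longest Lyndon prefix, which depends on \<open>s\<close> alone.\<close>

lemma lyndon_factorization_first_longest:
  assumes fac: "is_lyndon_factorization s ((f, e) # fs)" and w: "lyndon w" "prefix w s"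
  shows "length w \<le> length f"
proof -
  let ?L = "concat (map (\<lambda>(f, e). replicate e f) ((f, e) # fs))"
  have "sorted_wrt (>) (map fst ((f, e) # fs))"
    using fac unfolding is_lyndon_factorization_def
    by (simp add: successively_conv_sorted_wrt transp_def)
  moreover have "sorted_wrt (\<ge>) (concat (map (\<lambda>(f, e). replicate e f) gs))"
    if "sorted_wrt (>) (map fst gs)" for gs :: "('a list \<times> nat) list"
    using that
  proof (induction gs)
    case (Cons g gs)
    have "sorted_wrt (\<ge>) (replicate n h)" for n and h :: "'a list"
      by (induction n) auto
    then show ?case using Cons by (cases g) (force simp: sorted_wrt_append)
  qed simp
  ultimately have sorted: "sorted_wrt (\<ge>) ?L" by blast
  have "e \<ge> 1" using fac by (simp add: is_lyndon_factorization_Cons)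
  then obtain e' where "e = Suc e'" by (cases e) auto
  then obtain ls where ls: "?L = f # ls" by simp
  have "s = concat ?L"
    using fac unfolding is_lyndon_factorization_def concat_word_pow by simp
  then show ?thesis
    using lyndon_prefix_bound[of f ls w] sorted w unfolding ls by blast
qed

lemma lyndon_factorization_first_unique:
  assumes "is_lyndon_factorization s ((f, e) # fs)" "is_lyndon_factorization s ((g, d) # gs)"
  shows "f = g"
proof -
  have pre: "prefix h s" "lyndon h" if "is_lyndon_factorization s ((h, n) # hs)" for h n hs
    using that by (cases n; auto simp: is_lyndon_factorization_Cons word_pow_def)+
  have "length f = length g"
    using lyndon_factorization_first_longest[OF assms(1)] lyndon_factorization_first_longest[OF assms(2)]
      pre[OF assms(1)] pre[OF assms(2)] by (simp add: le_antisym)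
  then show ?thesis
    using pre(1)[OF assms(1)] pre(1)[OF assms(2)] by (metis prefix_order.eq_iff prefix_length_prefix order_refl)
qed

lemma is_lyndon_factorization_Nil_iff:
  "is_lyndon_factorization [] fs \<longleftrightarrow> fs = []"
proof (cases fs)
  case (Cons p ps)
  then show ?thesis
    by (cases p; cases "snd p")
       (auto simp: is_lyndon_factorization_Cons word_pow_def lyndon_def)
qed (simp add: is_lyndon_factorization_def)

text \<open>If \<open>d > e\<close>, cancelling \<open>e\<close> copies of \<open>f\<close> leaves a
  remainder with a factorization still starting with \<open>f\<close>. The head of \<open>fs\<close>
  would then be \<open>f\<close> again, against strict decrease.\<close>

lemma lyndon_factorization_exponent_le:
  assumes "is_lyndon_factorization s ((f, e) # fs)" "is_lyndon_factorization s ((f, d) # gs)"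
  shows "d \<le> e"
proof (rule ccontr)
  assume "\<not> d \<le> e"
  then have d: "d = e + (d - e)" "d - e \<ge> 1" by auto
  obtain s' where s': "s = word_pow f e @ s'" "is_lyndon_factorization s' fs"
    using assms(1) by (auto simp: is_lyndon_factorization_Cons)
  obtain s'' where s'': "s = word_pow f d @ s''" "is_lyndon_factorization s'' gs" "lyndon f"
      "gs \<noteq> [] \<longrightarrow> f > fst (hd gs)"
    using assms(2) by (auto simp: is_lyndon_factorization_Cons)
  have "word_pow f d = word_pow f e @ word_pow f (d - e)"
    by (subst d(1)) (simp add: word_pow_def replicate_add del: add_diff_inverse_nat)
  then have "s' = word_pow f (d - e) @ s''" using s'(1) s''(1) by simp
  then have *: "is_lyndon_factorization s' ((f, d - e) # gs)"
    using s'' d(2) by (simp add: is_lyndon_factorization_Cons)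
  show False
  proof (cases fs)
    case Nil
    then have "s' = []" using s'(2) by (simp add: is_lyndon_factorization_def)
    then show False using * by (simp add: is_lyndon_factorization_Nil_iff)
  next
    case (Cons p ps)
    then have "fst p = f"
      using lyndon_factorization_first_unique[OF _ *] s'(2) by (cases p) auto
    then show False using assms(1) Cons by (simp add: is_lyndon_factorization_Cons)
  qed
qed

lemma is_lyndon_factorization_unique:
  "is_lyndon_factorization s fs \<Longrightarrow> is_lyndon_factorization s gs \<Longrightarrow> fs = gs"
proof (induction fs arbitrary: s gs)
  case Nil
  then have "s = []" by (simp add: is_lyndon_factorization_def)
  then show ?case using Nil by (simp add: is_lyndon_factorization_Nil_iff)
next
  case (Cons p fs)
  obtain f e where p: "p = (f, e)" by (cases p)
  have "gs \<noteq> []"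
  proof
    assume "gs = []"
    then have "s = []" using Cons.prems(2) by (simp add: is_lyndon_factorization_def)
    then show False using Cons.prems(1) by (simp add: is_lyndon_factorization_Nil_iff)
  qed
  then obtain g d gs' where gs: "gs = (g, d) # gs'" by (metis neq_Nil_conv surj_pair)
  have "g = f"
    using lyndon_factorization_first_unique Cons.prems unfolding p gs by metis
  moreover have "d = e"
    using lyndon_factorization_exponent_le Cons.prems unfolding p gs \<open>g = f\<close> by (metis le_antisym)
  ultimately show ?case
    using Cons.prems Cons.IH unfolding p gs by (auto simp: is_lyndon_factorization_Cons)
qed

lemma lyndon_size_eqI: "is_lyndon_factorization s fs \<Longrightarrow> lyndon_size s = length fs"
  unfolding lyndon_size_def lyndon_factorization_def
  by (metis the_equality is_lyndon_factorization_unique)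

section \<open>Greedy factorizations phrase by phrase\<close>

text \<open>
  \<open>lz_run u ps w\<close>: with \<open>u\<close> already processed, the greedy algorithm cuts off the phrases \<open>ps\<close> and
  leaves \<open>w\<close>. Keeping \<open>w\<close> explicit allows the same phrases to be used in every longer word.
\<close>

primrec lz_run :: "'a list \<Rightarrow> 'a list list \<Rightarrow> 'a list \<Rightarrow> bool" where
  "lz_run u [] w \<longleftrightarrow> True"
| "lz_run u (p # ps) w \<longleftrightarrow> is_lz_phrase u (p @ concat ps @ w) p \<and> lz_run (u @ p) ps w"

lemma lz_run_append:
  "lz_run u (ps @ qs) w \<longleftrightarrow> lz_run u ps (concat qs @ w) \<and> lz_run (u @ concat ps) qs w"
  by (induction ps arbitrary: u) auto

lemma lz_run_iff:
  "lz_run u ps [] \<longleftrightarrow>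
     (\<forall>i < length ps. is_lz_phrase (u @ concat (take i ps)) (concat (drop i ps)) (ps ! i))"
proof (induction ps arbitrary: u)
  case (Cons p ps)
  show ?case by (simp add: Cons All_less_Suc2)
qed simp

lemma is_lz_factorization_iff: "is_lz_factorization s ps \<longleftrightarrow> s = concat ps \<and> lz_run [] ps []"
  by (simp add: is_lz_factorization_def lz_run_iff)

lemma is_lz_phrase_unique:
  assumes "is_lz_phrase u v p" "is_lz_phrase u v q"
  shows "p = q"
proof -
  have excl: "hd v \<in> set u" if "r \<noteq> []" "prefix r v" "sublist r u" for r
    using that by (cases r; cases v) (auto dest!: set_mono_sublist)
  consider c w where "v = c # w" "c \<notin> set u" "p = [c]"
    | "p \<noteq> []" "prefix p v" "sublist p u" "\<forall>q. prefix q v \<and> sublist q u \<longrightarrow> length q \<le> length p"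
    using assms(1) by (auto simp: is_lz_phrase_def)
  then show ?thesis
  proof cases
    case 1
    then show ?thesis using assms(2) excl[of q] by (auto simp: is_lz_phrase_def)
  next
    case 2
    then have q: "q \<noteq> []" "prefix q v" "sublist q u" "\<forall>p. prefix p v \<and> sublist p u \<longrightarrow> length p \<le> length q"
      using assms(2) excl[of p] by (auto simp: is_lz_phrase_def)
    then have "length p = length q" using 2 by (simp add: le_antisym)
    then show ?thesis using 2(2) q(2) by (metis prefix_order.eq_iff prefix_length_prefix order_refl)
  qed
qed

lemma is_lz_phrase_nonempty: "is_lz_phrase u v p \<Longrightarrow> p \<noteq> []"
  by (auto simp: is_lz_phrase_def)

lemma lz_run_unique:
  "lz_run u ps [] \<Longrightarrow> lz_run u qs [] \<Longrightarrow> concat ps = concat qs \<Longrightarrow> ps = qs"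
proof (induction ps arbitrary: u qs)
  case Nil
  then show ?case by (cases qs) (auto dest: is_lz_phrase_nonempty)
next
  case (Cons p ps)
  then obtain q qs' where qs: "qs = q # qs'"
    by (cases qs) (auto dest: is_lz_phrase_nonempty)
  then have "q = p"
    using Cons.prems is_lz_phrase_unique[of u "concat (p # ps)" p q] by auto
  then show ?case using Cons unfolding qs by auto
qed

lemma lz_size_eqI: "lz_run [] ps [] \<Longrightarrow> lz_size (concat ps) = length ps"
proof -
  assume "lz_run [] ps []"
  then have "lz_factorization (concat ps) = ps"
    unfolding lz_factorization_def is_lz_factorization_iff
    by (intro the_equality) (auto intro: lz_run_unique)
  then show ?thesis by (simp add: lz_size_def)
qed

text \<open>Any longer prefix of the remaining text contains \<open>p\<close> extended by one
  letter, so maximality needs only that single extension to be new. If \<open>w\<close> is empty, no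
  longer prefix exists and \<open>c\<close> may be any letter.\<close>

lemma is_lz_phraseI:
  assumes "p \<noteq> []" "sublist p u" "\<not> sublist (p @ [c]) u" "w \<noteq> [] \<longrightarrow> hd w = c"
  shows "is_lz_phrase u (p @ w) p"
proof -
  have "length q \<le> length p" if q: "prefix q (p @ w)" "sublist q u" for q
  proof (rule ccontr)
    assume "\<not> length q \<le> length p"
    then have "\<not> prefix q p" using prefix_length_le by blast
    then obtain y where y: "q = p @ y" "prefix y w" "y \<noteq> []"
      using q(1) by (auto simp: prefix_append)
    then obtain y' where "q = (p @ [c]) @ y'"
      using assms(4) by (cases y; cases w) auto
    then have "sublist (p @ [c]) q" by blast
    then show False using assms(3) q(2) by (metis sublist_order.order_trans)
  qed
  then show ?thesis using assms by (auto simp: is_lz_phrase_def)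
qed

section \<open>Words described by their run lengths\<close>

text \<open>The trailing \<open>r\<close> is a run not yet closed by a \<open>b\<close>: phrases end
  in the middle of a run, so processed texts have this form.\<close>

primrec runs :: "nat list \<Rightarrow> nat \<Rightarrow> letter list" where
  "runs [] r = replicate r LA"
| "runs (x # xs) r = replicate x LA @ LB # runs xs r"

lemma runs_append: "runs (xs @ ys) r = runs xs 0 @ runs ys r"
  by (induction xs) auto

section \<open>Locating factors in a word given by run lengths\<close>

lemma replicate_Cons_eq_iff:
  assumes "x \<noteq> y"
  shows "replicate j x @ y # u = replicate z x @ y # v \<longleftrightarrow> j = z \<and> u = v"
proof (induction j arbitrary: z)
  case 0
  then show ?case using assms by (cases z) auto
next
  case (Suc j)
  then show ?case using assms by (cases z) auto
qed

lemma replicate_prefix_imp_le: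
  assumes "x \<noteq> y" "prefix (replicate n x) (replicate z x @ y # v)"
  shows "n \<le> z"
  using assms(2)
proof (induction n arbitrary: z)
  case (Suc n)
  then show ?case using assms(1) by (cases z) auto
qed simp

text \<open>Each \<open>b\<close> closes exactly one run, so the text after it is again described by
  a tail of the list.\<close>

lemma runs_eq_append_LB:
  assumes "u @ LB # v = runs xs r"
  shows "\<exists>ys zs. xs = ys @ zs \<and> v = runs zs r"
  using assms
proof (induction xs arbitrary: u)
  case Nil
  then have "LB \<in> set (replicate r LA)" by (metis in_set_conv_decomp runs.simps(1))
  then show ?case by simp
next
  case (Cons x xs)
  then consider us where "u = replicate x LA @ us" "us @ LB # v = LB # runs xs r"
    | us where "u @ us = replicate x LA" "LB # v = us @ LB # runs xs r"
    by (auto simp: append_eq_append_conv2)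
  then show ?case
  proof cases
    case 1
    show ?thesis
    proof (cases us)
      case Nil
      then show ?thesis using 1 by (intro exI[of _ "[x]"] exI[of _ xs]) auto
    next
      case (Cons c us')
      then obtain ys zs where "xs = ys @ zs" "v = runs zs r" using 1 Cons.IH[of us'] by auto
      then show ?thesis by (intro exI[of _ "x # ys"] exI[of _ zs]) auto
    qed
  next
    case 2
    have "us = []"
    proof (rule ccontr)
      assume "us \<noteq> []"
      then have "LB \<in> set us" using 2(2) by (cases us) auto
      then have "LB \<in> set (replicate x LA)" by (simp flip: 2(1))
      then show False by simp
    qed
    then show ?thesis using 2 by (intro exI[of _ "[x]"] exI[of _ xs]) auto
  qed
qed

lemma prefix_runs_LB:
  assumes "prefix (replicate j LA @ LB # w) (runs zs r)"
  obtains zs' where "zs = j # zs'" "prefix w (runs zs' r)"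
proof (cases zs)
  case Nil
  then have "LB \<in> set (replicate r LA)"
    using set_mono_prefix[OF assms] by auto
  then show ?thesis by simp
next
  case (Cons z zs')
  then show ?thesis
    using assms that by (auto simp: prefix_def replicate_Cons_eq_iff)
qed

lemma prefix_runs_LA:
  assumes "prefix (replicate n LA @ w) (runs zs r)" "n > r"
  obtains z zs' where "zs = z # zs'" "n \<le> z"
proof (cases zs)
  case Nil
  then have "length (replicate n LA @ w) \<le> r"
    using prefix_length_le[OF assms(1)] by simp
  then show ?thesis using assms(2) by simp
next
  case (Cons z zs')
  then have "n \<le> z"
    using append_prefixD[OF assms(1)] replicate_prefix_imp_le[of LA LB n z] by simp
  then show ?thesis using that Cons by blast
qed

text \<open>The first \<open>b\<close> anchors the occurrence at the start of a run and the second
  fixes the length of that run, so occurrences correspond to positions in the list.\<close>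

lemma sublist_runs:
  assumes "sublist (LB # replicate j LA @ LB # w) (runs xs r)"
  obtains ys zs where "xs = ys @ j # zs" "prefix w (runs zs r)"
proof -
  obtain u v where "u @ LB # (replicate j LA @ LB # w @ v) = runs xs r"
    using assms by (auto simp: sublist_def)
  from runs_eq_append_LB[OF this] obtain ys zs where
    zs: "xs = ys @ zs" "replicate j LA @ LB # w @ v = runs zs r" by blast
  then have "prefix (replicate j LA @ LB # w) (runs zs r)" by (metis append.assoc append_Cons prefixI)
  then show ?thesis using prefix_runs_LB zs(1) that by metis
qed

lemma sublist_replicate_runs:
  assumes "sublist (replicate n LA) (runs xs r)" "\<forall>x \<in> set xs. x < n"
  shows "n \<le> r"
  using assms
proof (induction xs)
  case Nil
  then show ?case by (auto dest: sublist_length_le)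
next
  case (Cons x xs)
  have *: "sublist (replicate n LA) v"
    if "sublist (replicate n LA) (replicate z LA @ LB # v)" "z < n" for z v
    using that
  proof (induction z)
    case 0
    then show ?case by (cases n) (auto simp: sublist_Cons_right)
  next
    case (Suc z)
    then show ?case
      using replicate_prefix_imp_le[of LA LB n "Suc z" v] by (auto simp: sublist_Cons_right)
  qed
  then show ?case using Cons by auto
qed

section \<open>The run lengths of \<open>s_word\<close>\<close>

text \<open>The bound \<open>m\<close> is kept apart from \<open>n\<close> so that initial parts of
  block \<open>n\<close> can be described; the full block has runs \<open>n\<close> throughout
  \<open>pairs n n\<close> and one final \<open>n\<close>.\<close>

definition pairs :: "nat \<Rightarrow> nat \<Rightarrow> nat list" where
  "pairs n m = concat (map (\<lambda>i. [n, i]) [1..<m])"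

definition exps :: "nat \<Rightarrow> nat list" where
  "exps n = concat (map (\<lambda>i. pairs i i @ [i]) [0..<n])"

lemma pairs_Suc: "m \<ge> 1 \<Longrightarrow> pairs n (Suc m) = pairs n m @ [n, m]"
  by (simp add: pairs_def)

lemma pairs_unfold: "m \<ge> 2 \<Longrightarrow> \<exists>xs. pairs n m = n # 1 # xs"
  by (auto simp: pairs_def upt_conv_Cons)

lemma set_pairs: "set (pairs n m) \<subseteq> insert n {..<m}"
  by (auto simp: pairs_def)

lemma exps_Suc: "exps (Suc n) = exps n @ pairs n n @ [n]"
  by (simp add: exps_def)

lemma exps_less: "x \<in> set (exps n) \<Longrightarrow> x < n"
  using set_pairs by (fastforce simp: exps_def)

lemma runs_block: "block n = runs (pairs n n @ [n]) 0"
proof -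
  have "concat (map (\<lambda>j. word_pow [LA] n @ [LB] @ word_pow [LA] j @ [LB]) js)
      = runs (concat (map (\<lambda>i. [n, i]) js)) 0" for js
    by (induction js) (auto simp: word_pow_def)
  then show ?thesis
    by (auto simp: block_def pairs_def word_pow_def runs_append)
qed

lemma concat_blocks: "concat (map block [0..<n]) = runs (exps n) 0"
  by (induction n) (auto simp: exps_def runs_block runs_append)

lemma s_word_runs: "s_word n = runs (exps (Suc n)) 1"
  using runs_append[of "exps (Suc n)" "[]" 1] by (simp add: s_word_def concat_blocks del: upt_Suc)

section \<open>The Lyndon factorization of \<open>s_word\<close>\<close>

text \<open>After \<open>y\<close> common letters \<open>a\<close>, the word with the shorter run
  has \<open>b\<close> where the other still has \<open>a\<close>.\<close>

lemma runs_less: "y < x \<Longrightarrow> runs (x # xs) r < runs (y # ys) q"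
proof (induction y arbitrary: x)
  case 0
  then show ?case by (cases x) (auto simp: less_letter_def)
next
  case (Suc y)
  then show ?case by (cases x) auto
qed

lemma suffix_runs_Cons:
  assumes "suffix v (runs (x # xs) r)"
  shows "(\<exists>t \<le> x. v = runs (t # xs) r) \<or> suffix v (runs xs r)"
  using assms
proof (induction x)
  case 0
  then show ?case by (auto simp: suffix_Cons)
next
  case (Suc x)
  then have "v = runs (Suc x # xs) r \<or> suffix v (runs (x # xs) r)"
    by (auto simp: suffix_Cons)
  then show ?case using Suc.IH le_Suc_eq by blast
qed

text \<open>Every proper nonempty suffix starts with a run shorter than \<open>x\<close> closed by a
  \<open>b\<close>, hence is larger.\<close>

lemma lyndon_runs:
  assumes "\<forall>y \<in> set xs. y < x"
  shows "lyndon (runs (x # xs) 0)"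
proof -
  have suf: "\<exists>t zs. (t = x \<and> zs = xs \<or> t < x) \<and> v = runs (t # zs) 0"
    if "suffix v (runs (x # xs) 0)" "v \<noteq> []" for v
  proof -
    have "\<exists>t zs. t < x \<and> v = runs (t # zs) 0"
      if "suffix v (runs ys 0)" "\<forall>y \<in> set ys. y < x" for ys
      using that
    proof (induction ys)
      case Nil
      then show ?case using \<open>v \<noteq> []\<close> by simp
    next
      case (Cons y ys)
      from suffix_runs_Cons[OF Cons.prems(1)] show ?case
      proof
        assume "\<exists>t\<le>y. v = runs (t # ys) 0"
        then obtain t where "t \<le> y" "v = runs (t # ys) 0" by blast
        moreover have "y < x" using Cons.prems(2) by simp
        ultimately show ?thesis using order.strict_trans1 by blast
      next
        assume "suffix v (runs ys 0)"
        then show ?thesis using Cons by simp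
      qed
    qed
    then show ?thesis
      using suffix_runs_Cons[OF that(1)] assms le_neq_implies_less by metis
  qed
  have "runs (x # xs) 0 < v" if v: "strict_suffix v (runs (x # xs) 0)" "v \<noteq> []" for v
  proof -
    have "suffix v (runs (x # xs) 0)" "v \<noteq> runs (x # xs) 0"
      using v(1) by (auto simp: strict_suffix_def)
    then obtain t zs where "t < x" "v = runs (t # zs) 0"
      using suf[OF _ v(2)] by blast
    then show ?thesis using runs_less by blast
  qed
  then show ?thesis by (auto simp: lyndon_def)
qed

definition factors :: "nat \<Rightarrow> letter list list" where
  "factors n = map (\<lambda>j. runs [n, j] 0) [1..<n] @ [runs [n] 0]"

lemma concat_factors: "concat (factors n) = block n"
proof -
  have "concat (map (\<lambda>j. runs [n, j] 0) js) = runs (concat (map (\<lambda>i. [n, i]) js)) 0" for js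
    by (induction js) auto
  then show ?thesis
    by (auto simp: factors_def runs_block pairs_def runs_append)
qed

lemma lyndon_factors: "f \<in> set (factors n) \<Longrightarrow> lyndon f"
  using lyndon_runs[of "[]" n] lyndon_runs[of "[_]" n] by (auto simp: factors_def)

lemma prepend_less: "v < w \<Longrightarrow> u @ v < u @ (w :: 'a :: linorder list)"
  by (induction u) auto

text \<open>Growing \<open>j\<close> lowers the word, and the closing factor is smallest because it
  is a proper prefix of all the others.\<close>

lemma sorted_factors: "sorted_wrt (>) (factors n)"
proof -
  have 1: "runs [n, j] 0 < runs [n, i] 0" if "i < j" for i j
  proof -
    have "runs [j] 0 < runs [i] 0" using that by (rule runs_less)
    from prepend_less[OF this, of "replicate n LA @ [LB]"] show ?thesis by simp
  qed
  have 2: "runs [n] 0 < runs [n, i] 0" for i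
    using prepend_less[of "[]" "runs [i] 0" "replicate n LA @ [LB]"] by (cases i) auto
  have "sorted_wrt (>) (map (\<lambda>j. runs [n, j] 0) [1..<n])"
    unfolding sorted_wrt_map
    by (rule sorted_wrt_mono_rel[OF _ sorted_wrt_upt]) (use 1 in auto)
  then show ?thesis using 2 by (auto simp: factors_def sorted_wrt_append)
qed

lemma factors_form: "f \<in> set (factors n) \<Longrightarrow> \<exists>xs. f = runs (n # xs) 0"
  by (auto simp: factors_def simp del: runs.simps)

lemma sorted_all_factors: "sorted_wrt (>) (concat (map factors [0..<n]))"
proof (induction n)
  case (Suc n)
  have "g < f" if f: "f \<in> set (factors m)" and "m < n" and g: "g \<in> set (factors n)" for f g m
    using factors_form[OF f] factors_form[OF g] runs_less[OF \<open>m < n\<close>] by blast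
  then show ?case using Suc sorted_factors by (auto simp: sorted_wrt_append)
qed simp

text \<open>Block 0 contributes one factor and block \<open>i \<ge> 1\<close> contributes
  \<open>i\<close>.\<close>

lemma length_all_factors: "2 * length (concat (map factors [0..<Suc n])) = n * (n + 1) + 2"
  by (induction n) (auto simp: factors_def)

lemma lyndon_size_s_word: "2 * lyndon_size (s_word k) = k * (k + 1) + 4"
proof -
  let ?F = "concat (map factors [0..<Suc k]) @ [[LA]]"
  have LA_less: "[LA] < f" if "f \<in> set (factors n)" for f n
  proof -
    obtain xs where "f = runs (n # xs) 0" using factors_form[OF \<open>f \<in> set (factors n)\<close>] by blast
    then show ?thesis by (cases n) (auto simp: less_letter_def, metis neq_Nil_conv Nil_less_Cons append_is_Nil_conv list.discI)
  qed
  have "sorted_wrt (>) ?F"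
    using sorted_all_factors[of "Suc k"] LA_less
    by (auto simp: sorted_wrt_append simp del: upt_Suc)
  then have "successively (>) ?F"
    by (rule successively_if_sorted_wrt)
  moreover have "lyndon [LA]"
    by (auto simp: lyndon_def strict_suffix_def suffix_Cons)
  moreover have "s_word k = concat ?F"
  proof -
    have "concat (concat (map factors ns)) = concat (map block ns)" for ns
      by (induction ns) (auto simp: concat_factors)
    then show ?thesis by (simp add: s_word_def del: upt_Suc)
  qed
  \<comment> \<open>All exponents are 1, since the factors are strictly decreasing.\<close>
  ultimately have "is_lyndon_factorization (s_word k) (map (\<lambda>f. (f, 1)) ?F)"
    unfolding is_lyndon_factorization_def
    by (auto simp: word_pow_def comp_def lyndon_factors simp del: upt_Suc)
  from lyndon_size_eqI[OF this] show ?thesis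
    using length_all_factors[of k] by (simp del: upt_Suc)
qed

section \<open>The LZ factorization of \<open>s_word\<close>\<close>

definition stage_mid :: "nat \<Rightarrow> nat \<Rightarrow> letter list list" where
  "stage_mid n m = map (\<lambda>j. LA # LB # replicate j LA @ LB # replicate (n - 1) LA) [2..<m]"

text \<open>Only \<open>n - 1\<close> letters \<open>a\<close> at the start: the final
  \<open>a\<close> of the preceding word supplies the first letter of the run of length
  \<open>n\<close>.\<close>

definition stage_init :: "nat \<Rightarrow> letter list" where
  "stage_init n = replicate (n - 1) LA @ LB # LA # LB # replicate (n - 1) LA"

definition stage_last :: "nat \<Rightarrow> letter list" where
  "stage_last n = LA # LB # replicate (n - 1) LA @ LB # replicate n LA @ [LB, LA]"

definition stage :: "nat \<Rightarrow> letter list list" where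
  "stage n = stage_init n # stage_mid n (n - 1) @ [stage_last n]"

lemma runs_snoc: "runs xs r @ replicate t LA @ LB # v = runs (xs @ [r + t]) 0 @ v"
  by (induction xs) (auto simp: replicate_add)

text \<open>Each middle phrase begins with the single \<open>a\<close> that completes a pending run
  of length \<open>n - 1\<close>, and leaves the next run pending at that same length.\<close>

lemma runs_stage_mid:
  assumes "n \<ge> 1" "m \<ge> 2"
  shows "runs (exps n) 1 @ stage_init n @ concat (stage_mid n m) = runs (exps n @ pairs n m) (n - 1)"
  using assms(2)
proof (induction m rule: dec_induct)
  case base
  have "pairs n 2 = [n, 1]" by (simp add: pairs_def upt_conv_Cons)
  then show ?case
    using assms(1) runs_snoc[of "exps n" 1 "n - 1"]
    by (simp add: stage_init_def stage_mid_def runs_append)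
next
  case (step m)
  have "runs (exps n) 1 @ stage_init n @ concat (stage_mid n (Suc m)) =
      runs (exps n @ pairs n m) (n - 1) @ LA # LB # replicate m LA @ LB # replicate (n - 1) LA"
    using step by (simp add: stage_mid_def flip: step.IH)
  also have "\<dots> = runs (exps n @ pairs n (Suc m)) (n - 1)"
    using assms(1) step runs_snoc[of "exps n @ pairs n m" "n - 1" 1]
    by (simp add: pairs_Suc runs_append)
  finally show ?case .
qed

lemma s_word_stage:
  assumes "n \<ge> 3"
  shows "s_word n = s_word (n - 1) @ concat (stage n)"
proof -
  have "s_word (n - 1) @ concat (stage n) = runs (exps n @ pairs n (n - 1)) (n - 1) @ stage_last n"
    using assms runs_stage_mid[of n "n - 1"] by (simp add: s_word_runs stage_def)
  also have "\<dots> = runs (exps n @ pairs n (n - 1) @ [n, n - 1] @ [n]) 1"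
    using assms runs_snoc[of "exps n @ pairs n (n - 1)" "n - 1" 1]
    by (simp add: stage_last_def runs_append)
  also have "pairs n (n - 1) @ [n, n - 1] @ [n] = pairs n n @ [n]"
    using pairs_Suc[of "n - 1" n] assms by simp
  finally show ?thesis by (simp add: s_word_runs exps_Suc)
qed

section \<open>Earlier occurrences of the new phrases and novelty of their extensions\<close>

lemma sublist_runs_middle: "sublist w (runs ys r') \<Longrightarrow> r' = 0 \<Longrightarrow> sublist w (runs (xs @ ys @ zs) r)"
  by (simp add: runs_append) (meson sublist_append_leftI sublist_append_rightI sublist_order.order_trans)

text \<open>The second \<open>m\<close> starts the next pair or, for the last \<open>j\<close>, is
  the lone run ending block \<open>m\<close>.\<close>

lemma exps_triple:
  assumes "1 \<le> j" "j < m"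
  shows "\<exists>xs ys. exps (Suc m) = xs @ [m, j, m] @ ys"
proof -
  have "[1..<m] = [1..<j] @ j # [Suc j..<m]"
    using assms by (metis upt_add_eq_append upt_conv_Cons less_imp_le le_add_diff_inverse)
  then have *: "pairs m m @ [m] = pairs m j @ [m, j] @ concat (map (\<lambda>i. [m, i]) [Suc j..<m]) @ [m]"
    by (simp add: pairs_def)
  have "\<exists>ys. concat (map (\<lambda>i. [m, i]) js) @ [m] = m # ys" for js
    by (cases js) auto
  then obtain ys where "concat (map (\<lambda>i. [m, i]) [Suc j..<m]) @ [m] = m # ys" by blast
  then have "exps (Suc m) = (exps m @ pairs m j) @ [m, j, m] @ ys"
    using * by (simp add: exps_Suc)
  then show ?thesis by blast
qed

lemma sublist_triple:
  assumes "1 \<le> j" "j < n - 1"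
  shows "sublist (replicate (n - 1) LA @ LB # replicate j LA @ LB # replicate (n - 1) LA)
    (runs (exps n @ zs) r)"
proof -
  obtain xs ys where "exps n = xs @ [n - 1, j, n - 1] @ ys"
    using exps_triple[OF assms] assms by auto
  moreover have "sublist (replicate (n - 1) LA @ LB # replicate j LA @ LB # replicate (n - 1) LA)
      (runs [n - 1, j, n - 1] 0)"
    by (intro prefix_imp_sublist) simp
  ultimately show ?thesis
    using sublist_runs_middle[of _ "[n - 1, j, n - 1]" 0 xs "ys @ zs" r] by simp
qed

text \<open>All entries of \<open>exps n\<close> are below \<open>n\<close>, so the neighbours
  \<open>j\<close> and \<open>z\<close> can only straddle the boundary between the two
  lists.\<close>

lemma split_exps_pairs:
  assumes eq: "exps n @ ps = ys @ j # z # zs" and "n \<le> z" "j \<notin> set ps"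
  shows "exps n = ys @ [j] \<and> ps = z # zs"
proof -
  from eq consider us where "exps n = ys @ us" "us @ ps = j # z # zs"
    | us where "ps = us @ j # z # zs"
    by (auto simp: append_eq_append_conv2)
  then show ?thesis
  proof cases
    case 1
    then obtain us' where us': "us = j # us'" using assms(3) by (cases us) auto
    moreover have "us' = []"
    proof (rule ccontr)
      assume "us' \<noteq> []"
      then have "z \<in> set (exps n)" using 1 us' by (cases us') auto
      then show False using exps_less \<open>n \<le> z\<close> by fastforce
    qed
    ultimately show ?thesis using 1 by simp
  next
    case 2
    then show ?thesis using assms(3) by simp
  qed
qed

lemma phrase_init:
  assumes "n \<ge> 3" "w \<noteq> [] \<longrightarrow> hd w = LA"
  shows "is_lz_phrase (s_word (n - 1)) (stage_init n @ w) (stage_init n)"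
proof (rule is_lz_phraseI)
  show "sublist (stage_init n) (s_word (n - 1))"
    using sublist_triple[of 1 n "[]" 1] assms(1) by (simp add: stage_init_def s_word_runs)
  show "\<not> sublist (stage_init n @ [LA]) (s_word (n - 1))"
  proof
    assume *: "sublist (stage_init n @ [LA]) (s_word (n - 1))"
    have "stage_init n @ [LA] = (replicate (n - 1) LA @ [LB, LA, LB]) @ replicate n LA"
      using assms(1) by (cases n) (auto simp: stage_init_def replicate_append_same)
    then have "sublist (replicate n LA) (stage_init n @ [LA])" by (metis sublist_append_leftI sublist_order.order_refl)
    then have "sublist (replicate n LA) (runs (exps n) 1)"
      using * assms(1) by (auto simp: s_word_runs intro: sublist_order.order_trans)
    \<comment> \<open>The closed runs are all shorter than \<open>n\<close>, so the occurrence would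
      force \<open>n \<le> 1\<close>, the length of the open run.\<close>
    from sublist_replicate_runs[OF this] show False using assms(1) exps_less by auto
  qed
qed (use assms in \<open>auto simp: stage_init_def\<close>)

lemma phrase_mid:
  assumes "n \<ge> 3" "2 \<le> j" "j < n - 1" "w \<noteq> [] \<longrightarrow> hd w = LA"
    and p: "p = LA # LB # replicate j LA @ LB # replicate (n - 1) LA"
  shows "is_lz_phrase (runs (exps n @ pairs n j) (n - 1)) (p @ w) p"
proof (rule is_lz_phraseI)
  \<comment> \<open>Dropping \<open>n - 2\<close> letters from the first run of the triple in block
    \<open>n - 1\<close> leaves \<open>p\<close>.\<close>
  have "suffix p (replicate (n - 1) LA @ LB # replicate j LA @ LB # replicate (n - 1) LA)"
    using assms(1) unfolding p suffix_def
    by (intro exI[of _ "replicate (n - 2) LA"])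
       (simp add: replicate_app_Cons_same flip: replicate_Suc Cons_replicate_eq append_Cons add: Suc_diff_Suc numeral_2_eq_2)
  then show "sublist p (runs (exps n @ pairs n j) (n - 1))"
    using sublist_triple[of j n] assms by (meson suffix_imp_sublist sublist_order.order_trans le_trans one_le_numeral)
  show "\<not> sublist (p @ [LA]) (runs (exps n @ pairs n j) (n - 1))"
  proof
    assume *: "sublist (p @ [LA]) (runs (exps n @ pairs n j) (n - 1))"
    have "p @ [LA] = [LA] @ LB # replicate j LA @ LB # replicate n LA"
      using assms(1) unfolding p by (cases n) (auto simp: replicate_append_same)
    then have "sublist (LB # replicate j LA @ LB # replicate n LA) (p @ [LA])"
      by (metis sublist_append_leftI sublist_order.order_refl)
    from sublist_order.order_trans[OF this *]
    obtain ys zs where zs: "exps n @ pairs n j = ys @ j # zs" "prefix (replicate n LA) (runs zs (n - 1))"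
      by (rule sublist_runs)
    \<comment> \<open>The open run has length \<open>n - 1\<close>, too short for \<open>n\<close>
      letters, so a closed run must follow.\<close>
    then obtain z zs' where z: "zs = z # zs'" "n \<le> z"
      using prefix_runs_LA[of n "[]" zs "n - 1"] assms(1) by auto
    have "j \<notin> set (pairs n j)" using set_pairs[of n j] assms by auto
    then have "exps n = ys @ [j]" using split_exps_pairs zs(1) z by metis
    moreover have "last (exps n) = n - 1" using exps_Suc[of "n - 1"] assms(1) by simp
    ultimately show False using assms(3) by simp
  qed
qed (use assms in auto)

lemma phrase_last:
  assumes "n \<ge> 3" "w \<noteq> [] \<longrightarrow> hd w = LA"
  shows "is_lz_phrase (runs (exps n @ pairs n (n - 1)) (n - 1)) (stage_last n @ w) (stage_last n)"
proof (rule is_lz_phraseI)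
  obtain ps where ps: "pairs n (n - 1) = [n, 1] @ ps"
    using pairs_unfold[of "n - 1" n] assms(1) by fastforce
  show "sublist (stage_last n) (runs (exps n @ pairs n (n - 1)) (n - 1))"
  proof -
    have "pairs (n - 1) (n - 1) = pairs (n - 1) (n - 2) @ [n - 1, n - 2]"
      using pairs_Suc[of "n - 2" "n - 1"] assms(1) by (simp add: numeral_2_eq_2 Suc_diff_Suc)
    then obtain xs where "exps n = xs @ [n - 2, n - 1]"
      using exps_Suc[of "n - 1"] assms(1) by auto
    then have *: "exps n @ pairs n (n - 1) = xs @ [n - 2, n - 1, n, 1] @ ps" using ps by simp
    \<comment> \<open>The source of the phrase straddles the end of block \<open>n - 1\<close> and
      the start of block \<open>n\<close>; only the last \<open>a\<close> of the run
      \<open>n - 2\<close> is used.\<close>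
    have "runs [n - 2, n - 1, n, 1] 0 = replicate (n - 3) LA @ stage_last n @ [LB]"
      using assms(1) by (cases "n - 2")
        (auto simp: stage_last_def replicate_append_same replicate_app_Cons_same numeral_3_eq_3)
    then have "sublist (stage_last n) (runs [n - 2, n - 1, n, 1] 0)"
      by (metis sublist_appendI)
    then show ?thesis unfolding * by (rule sublist_runs_middle) simp
  qed
  show "\<not> sublist (stage_last n @ [LA]) (runs (exps n @ pairs n (n - 1)) (n - 1))"
  proof
    assume *: "sublist (stage_last n @ [LA]) (runs (exps n @ pairs n (n - 1)) (n - 1))"
    have "stage_last n @ [LA] = [LA] @ LB # replicate (n - 1) LA @ LB # replicate n LA @ [LB, LA, LA]"
      by (simp add: stage_last_def)
    then have "sublist (LB # replicate (n - 1) LA @ LB # replicate n LA @ [LB, LA, LA]) (stage_last n @ [LA])"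
      by (metis sublist_append_leftI sublist_order.order_refl)
    from sublist_order.order_trans[OF this *]
    obtain ys zs where zs: "exps n @ pairs n (n - 1) = ys @ (n - 1) # zs"
        "prefix (replicate n LA @ LB # [LA, LA]) (runs zs (n - 1))"
      by (rule sublist_runs) simp
    obtain zs' where z: "zs = n # zs'" "prefix [LA, LA] (runs zs' (n - 1))"
      using prefix_runs_LB[OF zs(2)] by blast
    have "n - 1 \<notin> set (pairs n (n - 1))" using set_pairs[of n "n - 1"] assms by auto
    \<comment> \<open>The occurrence must lie across the block boundary, where the run after
      \<open>n\<close> has length 1 and cannot supply two letters \<open>a\<close>.\<close>
    then have "pairs n (n - 1) = n # zs'"
      using split_exps_pairs zs(1) z(1) by (metis order_refl)
    then have "zs' = 1 # ps" using ps by simp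
    then show False using z(2) by simp
  qed
qed (use assms in \<open>auto simp: stage_last_def\<close>)

section \<open>Chaining the phrases and counting them\<close>

lemma hd_concat_stage_mid: "concat (stage_mid n m) \<noteq> [] \<longrightarrow> hd (concat (stage_mid n m)) = LA"
  by (cases "[2..<m]") (auto simp: stage_mid_def)

lemma lz_run_stage_mid:
  assumes "n \<ge> 3" "2 \<le> m" "m \<le> n - 1" "w \<noteq> [] \<longrightarrow> hd w = LA"
  shows "lz_run (s_word (n - 1) @ stage_init n) (stage_mid n m) w"
  using assms(2-4)
proof (induction m arbitrary: w rule: dec_induct)
  case base
  then show ?case by (simp add: stage_mid_def)
next
  case (step m)
  let ?p = "LA # LB # replicate m LA @ LB # replicate (n - 1) LA"
  have "lz_run (s_word (n - 1) @ stage_init n) (stage_mid n m) (?p @ w)"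
    using step by (intro step.IH) auto
  moreover have "is_lz_phrase (s_word (n - 1) @ stage_init n @ concat (stage_mid n m)) (?p @ w) ?p"
    using phrase_mid[of n m w ?p] runs_stage_mid[of n m] step assms(1)
    by (simp add: s_word_runs)
  moreover have "stage_mid n (Suc m) = stage_mid n m @ [?p]"
    using step by (simp add: stage_mid_def)
  ultimately show ?case by (simp add: lz_run_append)
qed

lemma lz_run_stage:
  assumes "n \<ge> 3" "w \<noteq> [] \<longrightarrow> hd w = LA"
  shows "lz_run (s_word (n - 1)) (stage n) w"
proof -
  have last: "hd (stage_last n @ w) = LA" by (simp add: stage_last_def)
  have "is_lz_phrase (s_word (n - 1)) (stage_init n @ concat (stage_mid n (n - 1)) @ stage_last n @ w) (stage_init n)"
    using hd_concat_stage_mid[of n "n - 1"] last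
    by (intro phrase_init assms) (metis append_Nil hd_append2)
  moreover have "lz_run (s_word (n - 1) @ stage_init n) (stage_mid n (n - 1)) (stage_last n @ w)"
    using last assms(1) by (intro lz_run_stage_mid) auto
  moreover have "is_lz_phrase (s_word (n - 1) @ stage_init n @ concat (stage_mid n (n - 1))) (stage_last n @ w) (stage_last n)"
    using phrase_last[OF assms] runs_stage_mid[of n "n - 1"] assms(1) by (simp add: s_word_runs)
  ultimately show ?thesis by (simp add: stage_def lz_run_append)
qed

text \<open>The five phrases of the word for \<open>k = 2\<close> are checked directly, as the
  regular stages begin at \<open>n = 3\<close>.\<close>

lemma lz_run_s_word_2:
  assumes "w \<noteq> [] \<longrightarrow> hd w = LA"
  shows "lz_run [] [[LB], [LA], [LB, LA], [LA, LB, LA], [LB, LA, LA, LB, LA]] w"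
proof -
  have "is_lz_phrase [] ([LB] @ v) [LB]" "is_lz_phrase [LB] ([LA] @ v) [LA]" for v
    by (auto simp: is_lz_phrase_def)
  moreover have "is_lz_phrase [LB, LA] ([LB, LA] @ LA # v) [LB, LA]"
      "is_lz_phrase [LB, LA, LB, LA] ([LA, LB, LA] @ LB # v) [LA, LB, LA]" for v
    by (rule is_lz_phraseI; simp add: sublist_Cons_right)+
  moreover have "is_lz_phrase [LB, LA, LB, LA, LA, LB, LA] ([LB, LA, LA, LB, LA] @ w) [LB, LA, LA, LB, LA]"
    by (rule is_lz_phraseI[where c = LA]) (use assms in \<open>simp_all add: sublist_Cons_right\<close>)
  ultimately show ?thesis by simp
qed

text \<open>Quantifying over \<open>w\<close> makes the induction work: the next stage starts with
  \<open>a\<close>, so the earlier phrases stay greedy. Starting from five phrases, stage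
  \<open>n\<close> adds \<open>n - 1\<close>.\<close>

lemma lz_run_s_word:
  assumes "k \<ge> 2"
  shows "\<exists>ps. concat ps = s_word k \<and> 2 * length ps = k * (k - 1) + 8 \<and>
    (\<forall>w. (w \<noteq> [] \<longrightarrow> hd w = LA) \<longrightarrow> lz_run [] ps w)"
  using assms
proof (induction k rule: dec_induct)
  case base
  have "s_word 2 = concat [[LB], [LA], [LB, LA], [LA, LB, LA], [LB, LA, LA, LB, LA]]"
    by (simp add: s_word_def block_def word_pow_def numeral_2_eq_2)
  then show ?case
    by (intro exI[of _ "[[LB], [LA], [LB, LA], [LA, LB, LA], [LB, LA, LA, LB, LA]]"])
       (use lz_run_s_word_2 in \<open>simp del: lz_run.simps\<close>)
next
  case (step n)
  then obtain ps where ps: "concat ps = s_word n" "2 * length ps = n * (n - 1) + 8"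
      "\<And>w. (w \<noteq> [] \<longrightarrow> hd w = LA) \<Longrightarrow> lz_run [] ps w" by blast
  have "concat (ps @ stage (Suc n)) = s_word (Suc n)"
    using ps(1) s_word_stage[of "Suc n"] step by simp
  moreover have "2 * length (ps @ stage (Suc n)) = Suc n * (Suc n - 1) + 8"
  proof -
    obtain m where "n = Suc (Suc m)" using step(1) by (metis add_2_eq_Suc le_Suc_ex)
    then show ?thesis using ps(2) by (cases m; cases "m - 1") (auto simp: stage_def stage_mid_def)
  qed
  moreover have "lz_run [] (ps @ stage (Suc n)) w" if "w \<noteq> [] \<longrightarrow> hd w = LA" for w
  proof -
    have "hd (concat (stage (Suc n)) @ w) = LA"
      using step by (cases n) (auto simp: stage_def stage_init_def)
    then show ?thesis
      using ps lz_run_stage[of "Suc n" w] step that by (auto simp: lz_run_append)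
  qed
  ultimately show ?case by blast
qed

lemma lz_size_s_word: "k \<ge> 2 \<Longrightarrow> 2 * lz_size (s_word k) = k * (k - 1) + 8"
  using lz_run_s_word[of k] lz_size_eqI by (metis list.sel(1))

theorem theorem2:
  "(\<forall>k::nat. k \<ge> 2 \<longrightarrow>
      real (lyndon_size (s_word k)) = (real k)\<^sup>2 / 2 + real k / 2 + 2 \<and>
      real (lz_size (s_word k)) = (real k)\<^sup>2 / 2 - real k / 2 + 4) \<and>
   (\<lambda>k. real (lyndon_size (s_word k)) - real (lz_size (s_word k)))
     \<in> \<Theta>(\<lambda>k. sqrt (real (lz_size (s_word k))))"
proof -
  have m: "real (lyndon_size (s_word k)) = (real k)\<^sup>2 / 2 + real k / 2 + 2" for k
    using arg_cong[OF lyndon_size_s_word[of k], of real] by (simp add: power2_eq_square field_simps)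
  have z: "real (lz_size (s_word k)) = (real k)\<^sup>2 / 2 - real k / 2 + 4" if "k \<ge> 2" for k
    using arg_cong[OF lz_size_s_word[OF that], of real] that
    by (simp add: power2_eq_square field_simps of_nat_diff)
  have ev: "\<forall>\<^sub>F k in sequentially. real (lz_size (s_word k)) = (real k)\<^sup>2 / 2 - real k / 2 + 4"
    using eventually_ge_at_top[of 2] by eventually_elim (rule z)
  \<comment> \<open>For \<open>k \<ge> 2\<close> the sizes differ by exactly \<open>k - 2\<close>,
    while the square root grows like \<open>k / sqrt 2\<close>.\<close>
  have "(\<lambda>k. real k - 2) \<in> \<Theta>(\<lambda>k. sqrt ((real k)\<^sup>2 / 2 - real k / 2 + 4))"
    by real_asymp
  also have "?this \<longleftrightarrow> (\<lambda>k. real (lyndon_size (s_word k)) - real (lz_size (s_word k)))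
     \<in> \<Theta>(\<lambda>k. sqrt (real (lz_size (s_word k))))"
    by (intro landau_theta.in_cong_bigtheta bigthetaI_cong landau_theta.cong_ex)
       (use ev in \<open>eventually_elim, simp add: m\<close>)+
  finally show ?thesis using m z by blast
qed

end
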